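(* Let $a,b\in\mathbb{C}$, let $n\ge 1$ be an integer, and let $\mathbf{T}_n=\mathrm{tridiag}(a,b,a)\in\mathbb{C}^{n\times n}$. Let $\mathbf{Er}(\mathbf{T}_n)=\exp(\mathbf{T}_n)-\Psi(\mathbf{T}_n)$. Then for every real $s>0$, $$\|\mathbf{Er}(\mathbf{T}_n)\|_{\infty}\le \frac{4\,e^{\operatorname{Re}(b)+2|a|\cosh(s)}}{e^{s(2n+2)}-1}\,\bigl(G_n(s)+G_n(-s)\bigr),$$ where $G_n(s)=\dfrac{e^{s(n+2)}-e^{2s}}{e^{s}-1}$ and $G_n(-s)$ is given by the same formula with $s$ replaced by $-s$.
   Context: $\mathrm{tridiag}(a,b,a)$ denotes the $n\times n$ tridiagonal Toeplitz matrix with all main diagonal entries equal to $b$, all sub-diagonal and super-diagonal entries equal to $a$, and all other entries zero. $\exp$ is the matrix exponential and $\|\cdot\|_\infty$ is the maximum absolute row sum of a matrix. For an integer $k\ge 0$ and $x\in\mathbb{C}$, $I_k(x)=\sum_{s=0}^{\infty}\frac{1}{s!(k+s)!}\left(\frac{x}{2}\right)^{k+2s}$ is the modified Bessel function of the first kind. For a vector $\mathbf{u}$ of length $n$, $\mathrm{Toeplitz}\{\mathbf{u}\}$ is the $n\times n$ Toeplitz matrix whose first column and first row are both $\mathbf{u}$. For a vector $\mathbf{v}=(v_1,\dots,v_n)$, $\mathrm{Hankel}\{\mathbf{v}\}$ is the $n\times n$ Hankel matrix whose first column is $\mathbf{v}$ and whose last row is the reversal of $\mathbf{v}$; that is, its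 $(i,j)$ entry is $v_{i+j-1}$ if $i+j\le n+1$ and $v_{2n+1-i-j}$ otherwise. For $\mathbf{T}_n=\mathrm{tridiag}(a,b,a)$, define $\Psi(\mathbf{T}_n)=\mathrm{Toeplitz}\{\mathbf{u}_n\}-\mathrm{Hankel}\{\mathbf{v}_n\}$, where $\mathbf{u}_n=(e^bI_0(2a),e^bI_1(2a),\dots,e^bI_{n-1}(2a))$ and $\mathbf{v}_n=(e^bI_2(2a),e^bI_3(2a),\dots,e^bI_{n+1}(2a))$. *)

theory Defs
  imports "HOL-Analysis.Analysis" "Jordan_Normal_Form.Matrix"
begin

text \<open>Matrices are those of \<open>Jordan_Normal_Form.Matrix\<close>: entries are indexed from 0, so
  the mathematical \<open>(i, j)\<close> entry is entry \<open>(i - 1, j - 1)\<close> here.\<close>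

definition tridiag :: "nat \<Rightarrow> complex \<Rightarrow> complex \<Rightarrow> complex \<Rightarrow> complex mat" where
  "tridiag n a b c = mat n n (\<lambda>(i, j).
     if i = j then b else if i = Suc j then a else if j = Suc i then c else 0)"

text \<open>The matrix exponential is the power series \<open>\<Sum>k. A ^ k / k!\<close>; the limit is taken entrywise,
  since the type of matrices of all dimensions carries no topology. Convergence for every square
  matrix is \<open>summable_mat_exp\<close> below.\<close>

definition mat_exp :: "complex mat \<Rightarrow> complex mat" where
  "mat_exp A = mat (dim_row A) (dim_col A) (\<lambda>(i, j). \<Sum>k. (A ^\<^sub>m k) $$ (i, j) / fact k)"

text \<open>Maximum absolute row sum; only meaningful for matrices with at least one row.\<close>

definition mat_norm_inf :: "complex mat \<Rightarrow> real" where
  "mat_norm_inf A = Max ((\<lambda>i. \<Sum>j<dim_col A. cmod (A $$ (i, j))) ` {..<dim_row A})"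

definition bessel_I :: "nat \<Rightarrow> complex \<Rightarrow> complex" where
  "bessel_I k x = (\<Sum>s. 1 / (fact s * fact (k + s)) * (x / 2) ^ (k + 2 * s))"

text \<open>The symmetric Toeplitz matrix with first row and first column \<open>u\<close>.\<close>

definition toeplitz :: "complex vec \<Rightarrow> complex mat" where
  "toeplitz u = mat (dim_vec u) (dim_vec u) (\<lambda>(i, j). u $ (if i \<le> j then j - i else i - j))"

text \<open>The Hankel matrix with first column \<open>v\<close> and last row the reversal of \<open>v\<close>. With indices
  from 1, the condition is \<open>i + j \<le> n + 1\<close> and the entries are \<open>v (i + j - 1)\<close> and
  \<open>v (2 * n + 1 - i - j)\<close>; the natural-number subtraction below never truncates, as
  \<open>i, j \<le> n - 1\<close>.\<close>

definition hankel :: "complex vec \<Rightarrow> complex mat" where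
  "hankel v = (let n = dim_vec v in
     mat n n (\<lambda>(i, j). if i + j < n then v $ (i + j) else v $ (2 * n - 2 - i - j)))"

text \<open>\<open>\<Psi>\<close> takes \<open>n, a, b\<close> rather than the matrix \<open>tridiag n a b a\<close>, which for \<open>n = 1\<close> does not
  determine \<open>a\<close>.\<close>

definition Psi :: "nat \<Rightarrow> complex \<Rightarrow> complex \<Rightarrow> complex mat" where
  "Psi n a b =
     toeplitz (vec n (\<lambda>k. exp b * bessel_I k (2 * a))) -
     hankel (vec n (\<lambda>k. exp b * bessel_I (k + 2) (2 * a)))"

definition Er :: "nat \<Rightarrow> complex \<Rightarrow> complex \<Rightarrow> complex mat" where
  "Er n a b = mat_exp (tridiag n a b a) - Psi n a b"

definition G :: "nat \<Rightarrow> real \<Rightarrow> real" where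
  "G n s = (exp (s * (real n + 2)) - exp (2 * s)) / (exp s - 1)"

lemma summable_mat_exp:
  fixes A :: "complex mat"
  assumes A: "A \<in> carrier_mat n n" and "i < n" "j < n"
  shows "summable (\<lambda>k. (A ^\<^sub>m k) $$ (i, j) / fact k)"
proof -
  define C where "C = (\<Sum>j<n. \<Sum>l<n. cmod (A $$ (l, j)))"
  have C0: "C \<ge> 0" unfolding C_def by (intro sum_nonneg) auto
  have bound: "cmod ((A ^\<^sub>m k) $$ (i, j)) \<le> C ^ k" if "j < n" for k j
    using that
  proof (induction k arbitrary: j)
    case 0
    then show ?case using A \<open>i < n\<close> by (auto simp: one_mat_def)
  next
    case (Suc k)
    have P: "A ^\<^sub>m k \<in> carrier_mat n n" using A by (rule pow_carrier_mat)
    have "(A ^\<^sub>m Suc k) $$ (i, j) = (\<Sum>l<n. (A ^\<^sub>m k) $$ (i, l) * A $$ (l, j))"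
      using A P Suc.prems \<open>i < n\<close>
      by (simp add: scalar_prod_def lessThan_atLeast0)
    also have "cmod \<dots> \<le> (\<Sum>l<n. cmod ((A ^\<^sub>m k) $$ (i, l)) * cmod (A $$ (l, j)))"
      by (rule order.trans[OF norm_sum]) (simp add: norm_mult)
    also have "\<dots> \<le> (\<Sum>l<n. C ^ k * cmod (A $$ (l, j)))"
      by (intro sum_mono mult_right_mono Suc.IH) auto
    also have "\<dots> = C ^ k * (\<Sum>l<n. cmod (A $$ (l, j)))"
      by (simp add: sum_distrib_left)
    also have "\<dots> \<le> C ^ k * C" unfolding C_def
      by (intro mult_left_mono member_le_sum[where f = "\<lambda>j. \<Sum>l<n. cmod (A $$ (l, j))"]
            zero_le_power sum_nonneg) (use Suc.prems in auto)
    finally show ?case by (simp add: mult.commute)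
  qed
  have "summable (\<lambda>k. C ^ k / fact k)"
    using summable_exp_generic[of C] by (simp add: divide_inverse mult.commute)
  then show ?thesis
    by (rule summable_comparison_test')
       (use bound[OF \<open>j < n\<close>] in \<open>auto simp: norm_divide intro!: divide_right_mono\<close>)
qed

end

theory Submission
  imports Defs
begin

text \<open>Expanding in powers of \<open>a\<close>, the coefficient of \<open>a\<^sup>k / k!\<close> in
  \<open>I\<^sub>d (2 a)\<close> counts \<open>k\<close>-step walks on the integers with displacement \<open>d\<close>, and the same
  coefficient in \<open>exp (- b)\<close> times the exponential of the tridiagonal matrix counts walks on the
  path \<open>1, \<dots>, n\<close>. Put \<open>N = n + 1\<close> and fix the start \<open>i\<close>. Path walks, minus free walks from
  \<open>i\<close>, plus free walks from the reflections \<open>- i\<close> and \<open>2 N - i\<close> of \<open>i\<close> in the walls \<open>0\<close>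
  and \<open>N\<close>, form a defect that obeys the walk recursion in \<open>0 < j < N\<close>, vanishes for
  \<open>k = 0\<close>, and on the walls counts free walks with displacement at least \<open>N\<close>. By a discrete
  maximum principle it lies between 0 and
  \<open>(2 cosh s)\<^sup>k 2 cosh (s (i - j)) / (exp (2 s N) - 1)\<close>, which solves the recursion exactly.
  The coefficient of the error is this defect minus one more free walk count, which is bounded in
  the same way.\<close>

section \<open>Walk counts on the integers and on the path\<close>

primrec free_walks :: "nat \<Rightarrow> int \<Rightarrow> nat" where
  "free_walks 0 d = (if d = 0 then 1 else 0)"
| "free_walks (Suc k) d = free_walks k (d - 1) + free_walks k (d + 1)"

text \<open>The walls \<open>0\<close> and \<open>N\<close> absorb. No wall is tested at
  \<open>k = 0\<close>, so the vanishing of counts outside the path relies on a start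
  \<open>i\<close> strictly between the walls.\<close>

primrec path_walks :: "int \<Rightarrow> int \<Rightarrow> nat \<Rightarrow> int \<Rightarrow> nat" where
  "path_walks N i 0 j = (if i = j then 1 else 0)"
| "path_walks N i (Suc k) j =
     (if 0 < j \<and> j < N then path_walks N i k (j - 1) + path_walks N i k (j + 1) else 0)"

lemma free_walks_minus: "free_walks k (- d) = free_walks k d"
proof (induction k arbitrary: d)
  case (Suc k)
  have "- d - 1 = - (d + 1)" "- d + 1 = - (d - 1)" by simp_all
  then show ?case by (simp only: free_walks.simps Suc add.commute)
qed auto

lemma free_walks_odd: "odd (int k + d) \<Longrightarrow> free_walks k d = 0"
  by (induction k arbitrary: d) auto

text \<open>A walk of \<open>k\<close> steps, \<open>r\<close> of them to the right, ends at
  \<open>2 * r - k\<close>; in this parametrization the recursion is Pascal's rule. An integer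
  \<open>r\<close> lets the induction pass to \<open>r - 1\<close> without truncation.\<close>

lemma free_walks_binomial:
  "free_walks k (2 * r - int k) = (if r \<ge> 0 then k choose nat r else 0)"
proof (induction k arbitrary: r)
  case 0
  show ?case by (cases "r = 0") (auto simp: binomial_eq_0)
next
  case (Suc k)
  have "free_walks (Suc k) (2 * r - int (Suc k))
      = free_walks k (2 * (r - 1) - int k) + free_walks k (2 * r - int k)"
    by (simp add: algebra_simps)
  also have "\<dots> = (if r \<ge> 0 then Suc k choose nat r else 0)"
  proof (cases "r > 0")
    case True
    then obtain m where "r = int (Suc m)"
      by (metis gr0_implies_Suc zero_less_imp_eq_int)
    then show ?thesis by (simp only: Suc) (simp add: nat_add_distrib)
  next
    case False
    then show ?thesis by (cases "r = 0") (simp_all only: Suc, simp_all)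
  qed
  finally show ?case .
qed

lemma free_walks_nonzero_imp:
  assumes "free_walks k (int d) \<noteq> 0"
  shows "\<exists>m. k = d + 2 * m"
proof -
  have "even (int k + int d)" using assms free_walks_odd[of k "int d"] by auto
  then obtain r where r: "int k + int d = 2 * r" by (elim evenE)
  then have "free_walks k (2 * r - int k) \<noteq> 0" using assms by (simp flip: r)
  then have "r \<ge> 0" "nat r \<le> k"
    by (auto simp: free_walks_binomial not_le split: if_splits intro: ccontr)
  then have "k = d + 2 * nat (int k - r)" using r by linarith
  then show ?thesis by blast
qed

lemma free_walks_le_power: "free_walks k d \<le> 2 ^ k"
  by (induction k arbitrary: d) (auto simp: mult_2 intro: add_mono)

lemma path_walks_le_power: "path_walks N i k j \<le> 2 ^ k"
  by (induction k arbitrary: j) (auto simp: mult_2 intro: add_mono)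

section \<open>Exponential generating series and Bessel functions\<close>

lemma summable_norm_exponential_walks:
  fixes a :: complex and c :: "nat \<Rightarrow> nat"
  assumes "\<And>k. c k \<le> 2 ^ k"
  shows "summable (\<lambda>k. norm (a ^ k / fact k * of_nat (c k)))"
proof (rule summable_comparison_test')
  show "summable (\<lambda>k. (2 * cmod a) ^ k /\<^sub>R fact k)"
    using summable_exp_generic[of "2 * cmod a"] .
  fix k :: nat
  have "real (c k) \<le> 2 ^ k"
    using of_nat_mono[OF assms[of k], where 'a = real] by simp
  then have "cmod a ^ k / fact k * real (c k) \<le> cmod a ^ k / fact k * 2 ^ k"
    by (intro mult_left_mono) auto
  then show "norm (norm (a ^ k / fact k * of_nat (c k))) \<le> (2 * cmod a) ^ k /\<^sub>R fact k"
    by (simp add: norm_mult norm_divide norm_power power_mult_distrib field_simps)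
qed

text \<open>Only \<open>k = d + 2 * m\<close> contributes. There the count is
  \<open>k choose (d + m)\<close>, and division by \<open>fact k\<close> leaves
  \<open>1 / (fact m * fact (d + m))\<close>, the Bessel coefficient.\<close>

lemma bessel_I_sums_free_walks:
  "(\<lambda>k. a ^ k / fact k * of_nat (free_walks k (int d))) sums bessel_I d (2 * a)"
proof -
  let ?f = "\<lambda>k. a ^ k / fact k * of_nat (free_walks k (int d)) :: complex"
  let ?g = "\<lambda>m. d + 2 * m"
  have mono: "strict_mono ?g" by (simp add: strict_mono_def)
  have eq: "?f (?g m) = 1 / (fact m * fact (d + m)) * ((2 * a) / 2) ^ (d + 2 * m)" for m
  proof -
    have "free_walks (d + 2 * m) (int d) = (d + 2 * m) choose (d + m)"
    proof -
      have eq: "2 * int (d + m) - int (d + 2 * m) = int d" by simp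
      show ?thesis using free_walks_binomial[of "d + 2 * m" "int (d + m)"]
        unfolding eq nat_int by simp
    qed
    moreover have "of_nat ((d + 2 * m) choose (d + m))
        = (fact (d + 2 * m) / (fact (d + m) * fact m) :: complex)"
      by (subst binomial_fact) auto
    ultimately show ?thesis by simp
  qed
  have out: "?f k = 0" if "k \<notin> range ?g" for k
    using free_walks_nonzero_imp[of k d] that by auto
  have "summable ?f"
    by (intro summable_norm_cancel[OF summable_norm_exponential_walks] free_walks_le_power)
  then have "?f sums suminf ?f" by (rule summable_sums)
  then have "(\<lambda>m. ?f (?g m)) sums suminf ?f"
    using sums_mono_reindex[where f = ?f, OF mono out] by blast
  then have "suminf ?f = bessel_I d (2 * a)"
    unfolding bessel_I_def eq by (simp add: sums_iff)
  with \<open>?f sums suminf ?f\<close> show ?thesis by simp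
qed

section \<open>Exponential bounds and the reflection defect\<close>

text \<open>As a function of \<open>d\<close>, \<open>exp (- (s * d))\<close> is an eigenfunction of
  the step operator with eigenvalue \<open>2 * cosh s\<close>, so the bound satisfies the recursion
  with equality.\<close>

lemma free_walks_le:
  "real (free_walks k d) \<le> (2 * cosh s) ^ k * exp (- (s * of_int d))"
proof (induction k arbitrary: d)
  case 0
  show ?case by auto
next
  case (Suc k)
  have "real (free_walks (Suc k) d)
      \<le> (2 * cosh s) ^ k * exp (- (s * of_int (d - 1)))
        + (2 * cosh s) ^ k * exp (- (s * of_int (d + 1)))"
    using Suc[of "d - 1"] Suc[of "d + 1"] by simp
  also have "\<dots> = (2 * cosh s) ^ Suc k * exp (- (s * of_int d))"
    by (simp add: cosh_def algebra_simps exp_add exp_diff exp_minus field_simps)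
  finally show ?case .
qed

text \<open>Weakens the exponential bound to the barrier of \<open>walk_defect_bounds\<close>, for
  use at the walls and for the leftover count in \<open>Er_entry_bound\<close>.\<close>

lemma free_walks_reflected_le:
  fixes s :: real and N :: int
  assumes "s > 0" "N > 0"
  shows "real (free_walks k (2 * N - d))
    \<le> (2 * cosh s) ^ k * (2 * cosh (s * of_int d) / (exp (2 * s * of_int N) - 1))"
proof -
  have D: "exp (2 * s * of_int N) > 1" using assms by simp
  have "exp (- (s * of_int (2 * N - d))) = exp (s * of_int d) / exp (2 * s * of_int N)"
    by (simp add: algebra_simps flip: exp_diff)
  also have "\<dots> \<le> 2 * cosh (s * of_int d) / (exp (2 * s * of_int N) - 1)"
    using D by (intro frac_le) (auto simp: cosh_def)
  finally have "(2 * cosh s) ^ k * exp (- (s * of_int (2 * N - d)))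
    \<le> (2 * cosh s) ^ k * (2 * cosh (s * of_int d) / (exp (2 * s * of_int N) - 1))"
    by (intro mult_left_mono) (auto intro!: zero_le_power)
  with free_walks_le[of k "2 * N - d" s] show ?thesis by linarith
qed

definition walk_defect :: "int \<Rightarrow> int \<Rightarrow> nat \<Rightarrow> int \<Rightarrow> real" where
  "walk_defect N i k j = real (path_walks N i k j) - real (free_walks k (i - j))
     + real (free_walks k (i + j)) + real (free_walks k (2 * N - i - j))"

lemma path_walks_outside:
  "0 < i \<Longrightarrow> i < N \<Longrightarrow> j \<le> 0 \<or> j \<ge> N \<Longrightarrow> path_walks N i k j = 0"
  by (cases k) auto

lemma walk_defect_bounds:
  fixes s :: real and N i j :: int
  assumes s: "s > 0" and i: "0 < i" "i < N" and "0 \<le> j" "j \<le> N"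
  shows "0 \<le> walk_defect N i k j \<and> walk_defect N i k j
    \<le> (2 * cosh s) ^ k * (2 * cosh (s * of_int (i - j)) / (exp (2 * s * of_int N) - 1))"
  using assms(4,5)
proof (induction k arbitrary: j)
  case 0
  have "exp (2 * s * of_int N) \<ge> 1" using s i by simp
  \<comment> \<open>The reflections \<open>- i\<close> and \<open>2 * N - i\<close> lie outside the
    range of \<open>j\<close>, and the first two terms cancel.\<close>
  moreover have "walk_defect N i 0 j = 0" using 0 i by (auto simp: walk_defect_def)
  ultimately show ?case by simp
next
  case (Suc k)
  consider "j = 0" | "j = N" | "0 < j" "j < N" using Suc.prems by linarith
  then show ?case
  proof cases
    case 1
    \<comment> \<open>At \<open>j = 0\<close> the displacements \<open>i - j\<close> and
      \<open>i + j\<close> agree, so their counts cancel.\<close>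
    have "walk_defect N i (Suc k) j = real (free_walks (Suc k) (2 * N - i))"
      unfolding walk_defect_def by (simp add: 1 path_walks_outside del: free_walks.simps)
    then show ?thesis
      using free_walks_reflected_le[of s N "Suc k" i] s i 1 by simp
  next
    case 2
    have "free_walks (Suc k) (i - N) = free_walks (Suc k) (N - i)"
      using free_walks_minus[of "Suc k" "i - N"] by (simp del: free_walks.simps)
    \<comment> \<open>Here the reflection in \<open>N\<close> cancels; the remaining displacement
      \<open>i + N\<close> is rewritten to fit the reflected bound.\<close>
    then have "walk_defect N i (Suc k) j = real (free_walks (Suc k) (2 * N - (N - i)))"
      unfolding walk_defect_def
      using 2 i by (simp add: path_walks_outside algebra_simps del: free_walks.simps)
    moreover have "cosh (s * of_int (N - i)) = cosh (s * of_int (i - j))"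
      using 2 cosh_minus[of "s * of_int (N - i)"] by (simp add: algebra_simps)
    ultimately show ?thesis
      using free_walks_reflected_le[of s N "Suc k" "N - i"] s i by simp
  next
    case 3
    let ?D = "exp (2 * s * of_int N) - 1"
    have step: "walk_defect N i (Suc k) j = walk_defect N i k (j - 1) + walk_defect N i k (j + 1)"
      using 3 by (simp add: walk_defect_def algebra_simps)
    \<comment> \<open>The addition theorem: one step multiplies the barrier by exactly
      \<open>2 * cosh s\<close>.\<close>
    have cosh: "2 * cosh (s * of_int (i - (j - 1))) + 2 * cosh (s * of_int (i - (j + 1)))
        = 2 * cosh s * (2 * cosh (s * of_int (i - j)))"
      by (simp add: cosh_def algebra_simps exp_add exp_diff exp_minus field_simps)
    have "walk_defect N i (Suc k) j
        \<le> (2 * cosh s) ^ k * (2 * cosh (s * of_int (i - (j - 1))) / ?D)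
          + (2 * cosh s) ^ k * (2 * cosh (s * of_int (i - (j + 1))) / ?D)"
      unfolding step using Suc.IH[of "j - 1"] Suc.IH[of "j + 1"] 3 by (intro add_mono) auto
    also have "\<dots> = (2 * cosh s) ^ k * ((2 * cosh (s * of_int (i - (j - 1)))
          + 2 * cosh (s * of_int (i - (j + 1)))) / ?D)"
      by (simp only: add_divide_distrib distrib_left)
    also have "\<dots> = (2 * cosh s) ^ Suc k * (2 * cosh (s * of_int (i - j)) / ?D)"
      unfolding cosh by (simp add: mult_ac)
    finally show ?thesis
      unfolding step using Suc.IH[of "j - 1"] Suc.IH[of "j + 1"] 3 by auto
  qed
qed

section \<open>Powers and exponential of the tridiagonal matrix\<close>

text \<open>The binomial theorem for \<open>b\<close> times the identity plus \<open>a\<close> times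
  the adjacency matrix of the path, whose powers count walks. Indices are shifted by one to put the
  walls at \<open>0\<close> and \<open>n + 1\<close>.\<close>

lemma tridiag_pow_entry:
  assumes "i < n" "j < n"
  shows "(tridiag n a b a ^\<^sub>m k) $$ (i, j) = (\<Sum>l\<le>k. of_nat (k choose l) * b ^ (k - l) *
    (a ^ l * of_nat (path_walks (int n + 1) (int i + 1) l (int j + 1))))"
  using assms(2)
proof (induction k arbitrary: j)
  case 0
  then show ?case using assms(1) by (simp add: tridiag_def)
next
  case (Suc k)
  let ?T = "tridiag n a b a"
  define c where "c l j = a ^ l * of_nat (path_walks (int n + 1) (int i + 1) l j)" for l j
  define u where "u k j = (\<Sum>l\<le>k. of_nat (k choose l) * b ^ (k - l) * c l j)" for k j
  have T: "?T \<in> carrier_mat n n" by (simp add: tridiag_def)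
  then have P: "?T ^\<^sub>m k \<in> carrier_mat n n" by (rule pow_carrier_mat)
  have IH: "(?T ^\<^sub>m k) $$ (i, l) = u k (int l + 1)" if "l < n" for l
    using Suc.IH[OF that] by (simp add: u_def c_def)
  have c_Suc: "c (Suc l) (int j + 1) = a * (c l (int j) + c l (int j + 2))" for l
    using Suc.prems by (simp add: c_def algebra_simps)
  \<comment> \<open>Zeros at the walls stand in for the missing neighbours of the first and last
    columns, so all columns share one recursion.\<close>
  have u_out: "u k (int 0) = 0" "u k (int n + 1) = 0"
    using assms(1) by (simp_all add: u_def c_def path_walks_outside)
  have "(?T ^\<^sub>m Suc k) $$ (i, j) = (\<Sum>l<n. (?T ^\<^sub>m k) $$ (i, l) * ?T $$ (l, j))"
    using T P Suc.prems assms(1) by (simp add: scalar_prod_def lessThan_atLeast0)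
  also have "\<dots> = (\<Sum>l<n. (if l = j then b * u k (int l + 1) else 0)
      + (if l = Suc j then a * u k (int l + 1) else 0)
      + (if Suc l = j then a * u k (int l + 1) else 0))"
    using Suc.prems by (intro sum.cong refl) (use T in \<open>auto simp: IH\<close>, auto simp: tridiag_def)
  also have "\<dots> = b * u k (int j + 1) + (if Suc j < n then a * u k (int j + 2) else 0)
      + (\<Sum>l<n. if Suc l = j then a * u k (int l + 1) else 0)"
    using Suc.prems by (simp add: sum.distrib sum.delta add.commute)
  also have "(\<Sum>l<n. if Suc l = j then a * u k (int l + 1) else 0) = a * u k (int j)"
    using Suc.prems u_out(1) by (cases j) (auto simp: sum.delta add.commute)
  also have "(if Suc j < n then a * u k (int j + 2) else 0) = a * u k (int j + 2)"
  proof (cases "Suc j < n")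
    case False
    then have eq: "int j + 2 = int n + 1" using Suc.prems by simp
    show ?thesis unfolding eq u_out(2) by simp
  qed simp
  also have "b * u k (int j + 1) + a * u k (int j + 2) + a * u k (int j) = u (Suc k) (int j + 1)"
  proof -
    \<comment> \<open>Pascal's rule splits the sum: the \<open>k choose Suc l\<close> part, with the
      term for \<open>0\<close>, yields the factor \<open>b\<close>; the \<open>k choose l\<close>
      part yields the step to the two neighbours.\<close>
    have "u (Suc k) (int j + 1) = b ^ Suc k * c 0 (int j + 1) +
        (\<Sum>l\<le>k. (of_nat (k choose l) + of_nat (k choose Suc l)) * b ^ (k - l) * c (Suc l) (int j + 1))"
      unfolding u_def by (subst sum.atMost_Suc_shift) simp
    also have "\<dots> = b ^ Suc k * c 0 (int j + 1)
        + (\<Sum>l\<le>k. of_nat (k choose Suc l) * b ^ (k - l) * c (Suc l) (int j + 1))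
        + (\<Sum>l\<le>k. of_nat (k choose l) * b ^ (k - l) * c (Suc l) (int j + 1))"
      by (simp add: sum.distrib algebra_simps)
    also have "b ^ Suc k * c 0 (int j + 1)
        + (\<Sum>l\<le>k. of_nat (k choose Suc l) * b ^ (k - l) * c (Suc l) (int j + 1))
        = (\<Sum>l\<le>Suc k. of_nat (k choose l) * b ^ (Suc k - l) * c l (int j + 1))"
      by (subst sum.atMost_Suc_shift) simp
    also have "\<dots> = (\<Sum>l\<le>k. of_nat (k choose l) * b ^ (Suc k - l) * c l (int j + 1))"
      by (simp add: binomial_eq_0)
    also have "\<dots> = b * u k (int j + 1)"
      unfolding u_def sum_distrib_left by (intro sum.cong) (auto simp: Suc_diff_le)
    also have "(\<Sum>l\<le>k. of_nat (k choose l) * b ^ (k - l) * c (Suc l) (int j + 1))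
        = a * u k (int j + 2) + a * u k (int j)"
      unfolding u_def sum_distrib_left sum.distrib[symmetric]
      by (intro sum.cong) (simp_all only: c_Suc, simp add: algebra_simps)
    finally show ?thesis by (simp add: add.assoc)
  qed
  finally show ?case by (simp add: u_def c_def)
qed

text \<open>The scalar part commutes with the rest, so its exponential factors out; entrywise this
  is a Cauchy product.\<close>

lemma mat_exp_tridiag_entry:
  assumes "i < n" "j < n"
  shows "mat_exp (tridiag n a b a) $$ (i, j) = exp b *
    (\<Sum>k. a ^ k / fact k * of_nat (path_walks (int n + 1) (int i + 1) k (int j + 1)))"
proof -
  let ?c = "\<lambda>k. a ^ k / fact k * of_nat (path_walks (int n + 1) (int i + 1) k (int j + 1)) :: complex"
  have "(\<Sum>k. ?c k) * (\<Sum>k. b ^ k /\<^sub>R fact k) = (\<Sum>k. \<Sum>l\<le>k. ?c l * (b ^ (k - l) /\<^sub>R fact (k - l)))"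
    by (rule Cauchy_product[OF summable_norm_exponential_walks[OF path_walks_le_power] summable_norm_exp])
  also have "\<dots> = (\<Sum>k. (tridiag n a b a ^\<^sub>m k) $$ (i, j) / fact k)"
    unfolding tridiag_pow_entry[OF assms] sum_divide_distrib
    by (intro suminf_cong sum.cong) (auto simp: binomial_fact scaleR_conv_of_real field_simps)
  finally show ?thesis using assms by (simp add: mat_exp_def tridiag_def exp_def mult.commute)
qed

section \<open>Entrywise error bound\<close>

text \<open>The Hankel index \<open>h\<close> is the smaller of the reflected displacements
  \<open>I + J\<close> and \<open>2 * N - I - J\<close>; the other is \<open>2 * N - h\<close>. The
  error coefficient is therefore the defect minus the count for \<open>2 * N - h\<close>.\<close>

lemma Er_entry_bound:
  fixes s :: real
  assumes s: "s > 0" and ij: "i < n" "j < n"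
  defines "h \<equiv> if i + j < n then i + j + 2 else 2 * n - i - j"
  shows "cmod (Er n a b $$ (i, j)) \<le> exp (Re b + 2 * cmod a * cosh s) *
    (2 * cosh (s * real h) / (exp (s * (2 * real n + 2)) - 1))"
proof -
  define N where "N = int n + 1"
  define I where "I = int i + 1"
  define J where "J = int j + 1"
  define d where "d = (if i \<le> j then j - i else i - j)"
  define p where "p k = path_walks N I k J" for k
  define C where "C = 2 * cosh (s * real h) / (exp (s * (2 * real n + 2)) - 1)"
  have IJ: "0 < I" "I < N" "0 < J" "J < N" "N > 0" using ij by (auto simp: I_def J_def N_def)
  have h: "int h = I + J \<and> int h \<le> 2 * N - I - J \<or> int h = 2 * N - I - J \<and> int h \<le> I + J"
    using ij by (auto simp: h_def I_def J_def N_def)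
  have d: "int d = \<bar>I - J\<bar>" by (auto simp: d_def I_def J_def)
  have exp_N: "exp (2 * s * of_int N) = exp (s * (2 * real n + 2))"
    by (simp add: N_def algebra_simps)
  have "exp (s * (2 * real n + 2)) > 1" using s by simp
  have walks_d: "free_walks k (I - J) = free_walks k (int d)" for k
    using d free_walks_minus[of k "I - J"] by (auto simp: abs_if split: if_splits)
  have coeff: "\<bar>real (p k) - real (free_walks k (int d)) + real (free_walks k (int h))\<bar>
      \<le> (2 * cosh s) ^ k * C" for k
  proof -
    have eq: "real (p k) - real (free_walks k (int d)) + real (free_walks k (int h))
        = walk_defect N I k J - real (free_walks k (2 * N - int h))"
      using h
    proof (elim disjE conjE)
      assume "int h = I + J"
      moreover from this have "2 * N - I - J = 2 * N - int h" by simp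
      ultimately show ?thesis by (simp only: walk_defect_def p_def walks_d)
    next
      assume "int h = 2 * N - I - J"
      moreover from this have "I + J = 2 * N - int h" by simp
      ultimately show ?thesis by (simp only: walk_defect_def p_def walks_d)
    qed
    have "cosh (s * of_int (I - J)) = cosh (s * real d)"
      using d cosh_minus[of "s * of_int (I - J)"] by (auto simp: abs_if algebra_simps split: if_splits)
    \<comment> \<open>Since \<open>\<bar>I - J\<bar>\<close> is at most either reflected
      displacement, both bounds can be stated in terms of \<open>h\<close> alone.\<close>
    also have "\<dots> \<le> cosh (s * real h)"
      using s h d IJ by (subst cosh_real_nonneg_le_iff) auto
    finally have "2 * cosh (s * of_int (I - J)) / (exp (2 * s * of_int N) - 1) \<le> C"
      unfolding C_def exp_N using \<open>exp (s * (2 * real n + 2)) > 1\<close> by (intro divide_right_mono) auto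
    then have "(2 * cosh s) ^ k * (2 * cosh (s * of_int (I - J)) / (exp (2 * s * of_int N) - 1))
        \<le> (2 * cosh s) ^ k * C"
      by (intro mult_left_mono) (auto intro!: zero_le_power)
    moreover have "0 \<le> walk_defect N I k J \<and> walk_defect N I k J
        \<le> (2 * cosh s) ^ k * (2 * cosh (s * of_int (I - J)) / (exp (2 * s * of_int N) - 1))"
      using walk_defect_bounds[of s I N J k] s IJ by simp
    moreover have "real (free_walks k (2 * N - int h)) \<le> (2 * cosh s) ^ k * C"
      using free_walks_reflected_le[of s N k "int h"] s IJ by (simp add: exp_N C_def)
    \<comment> \<open>Two numbers between 0 and the same bound differ by at most that bound.\<close>
    ultimately show ?thesis unfolding eq by linarith
  qed
  let ?f = "\<lambda>k. a ^ k / fact k *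
    of_real (real (p k) - real (free_walks k (int d)) + real (free_walks k (int h))) :: complex"
  have "(\<lambda>k. a ^ k / fact k * of_nat (p k)) sums (\<Sum>k. a ^ k / fact k * of_nat (p k))"
    unfolding p_def
    by (intro summable_sums summable_norm_cancel[OF summable_norm_exponential_walks]
        path_walks_le_power)
  then have "?f sums ((\<Sum>k. a ^ k / fact k * of_nat (p k)) - bessel_I d (2 * a) + bessel_I h (2 * a))"
    unfolding of_real_add of_real_diff of_real_of_nat_eq distrib_left right_diff_distrib
    by (intro sums_add sums_diff bessel_I_sums_free_walks)
  moreover have "Er n a b $$ (i, j)
      = exp b * ((\<Sum>k. a ^ k / fact k * of_nat (p k)) - bessel_I d (2 * a) + bessel_I h (2 * a))"
  proof -
    have "Psi n a b $$ (i, j) = exp b * bessel_I d (2 * a) - exp b * bessel_I h (2 * a)"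
      using ij by (auto simp: Psi_def toeplitz_def hankel_def d_def h_def Let_def
        intro!: arg_cong[where f = "\<lambda>m. bessel_I m (2 * a)"])
    moreover have "Er n a b $$ (i, j) = mat_exp (tridiag n a b a) $$ (i, j) - Psi n a b $$ (i, j)"
      using ij by (simp add: Er_def Psi_def toeplitz_def hankel_def Let_def)
    moreover have "mat_exp (tridiag n a b a) $$ (i, j) = exp b * (\<Sum>k. a ^ k / fact k * of_nat (p k))"
      using mat_exp_tridiag_entry[OF ij] by (simp only: p_def N_def I_def J_def)
    ultimately show ?thesis
      by (simp only: distrib_left right_diff_distrib) simp
  qed
  ultimately have Er: "Er n a b $$ (i, j) = exp b * suminf ?f" by (simp add: sums_iff)
  have majorant: "(\<lambda>k. (cmod a * (2 * cosh s)) ^ k /\<^sub>R fact k * C)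
      sums (exp (cmod a * (2 * cosh s)) * C)"
    by (intro sums_mult2 exp_converges)
  have "norm (?f k) \<le> (cmod a * (2 * cosh s)) ^ k /\<^sub>R fact k * C" for k
  proof -
    have "norm (?f k) = cmod a ^ k / fact k *
        \<bar>real (p k) - real (free_walks k (int d)) + real (free_walks k (int h))\<bar>"
      by (simp only: norm_mult norm_divide norm_power norm_of_real norm_fact)
    also have "\<dots> \<le> cmod a ^ k / fact k * ((2 * cosh s) ^ k * C)"
      by (intro mult_left_mono coeff) auto
    finally show ?thesis by (simp add: power_mult_distrib field_simps)
  qed
  then have "cmod (suminf ?f) \<le> exp (cmod a * (2 * cosh s)) * C"
    using norm_suminf_le[of ?f, OF _ sums_summable[OF majorant]] majorant by (simp add: sums_iff)
  then have "exp (Re b) * cmod (suminf ?f) \<le> exp (Re b) * (exp (cmod a * (2 * cosh s)) * C)"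
    by (intro mult_left_mono) auto
  then show ?thesis by (simp add: Er norm_mult exp_add C_def mult_ac)
qed

section \<open>Row sums\<close>

text \<open>A geometric sum, valid for both signs of \<open>s\<close>; adding the two signs produces
  the \<open>cosh\<close> terms of the entry bounds.\<close>

lemma G_conv_sum:
  assumes "s \<noteq> 0"
  shows "G n s = (\<Sum>k=2..n+1. exp (s * real k))"
proof -
  have ne: "exp s \<noteq> 1" using assms by simp
  have "(\<Sum>k=2..n+1. exp (s * real k)) = (\<Sum>k<n. exp (2 * s) * exp s ^ k)"
    by (rule sum.reindex_bij_witness[of _ "\<lambda>k. k + 2" "\<lambda>k. k - 2"])
       (auto simp: of_nat_diff algebra_simps simp flip: exp_of_nat_mult exp_add)
  also have "\<dots> = exp (2 * s) * ((exp s ^ n - 1) / (exp s - 1))"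
    using ne by (simp add: geometric_sum flip: sum_distrib_left)
  also have "\<dots> = G n s"
    by (simp add: G_def algebra_simps exp_add flip: exp_of_nat_mult)
  finally show ?thesis ..
qed

text \<open>Along a row the Hankel index is injective on each side of the antidiagonal, so each
  value from \<open>2\<close> to \<open>n + 1\<close> occurs at most twice.\<close>

lemma sum_hankel_index_le:
  fixes f :: "nat \<Rightarrow> real"
  assumes "\<And>k. f k \<ge> 0" and "i < n"
  shows "(\<Sum>j<n. f (if i + j < n then i + j + 2 else 2 * n - i - j)) \<le> 2 * (\<Sum>k=2..n+1. f k)"
proof -
  have le: "(\<Sum>j\<in>A. f (g j)) \<le> (\<Sum>k=2..n+1. f k)" if "inj_on g A" "g ` A \<subseteq> {2..n+1}" for g A
    using that sum.reindex[of g A f] sum_mono2[of "{2..n+1}" "g ` A" f] assms(1) by simp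
  have split: "{..<n} = {..<n - i} \<union> {n - i..<n}" by auto
  have "(\<Sum>j<n. f (if i + j < n then i + j + 2 else 2 * n - i - j))
      = (\<Sum>j<n - i. f (i + j + 2)) + (\<Sum>j=n - i..<n. f (2 * n - i - j))"
    unfolding split by (subst sum.union_disjoint) (auto intro!: arg_cong2[where f = "(+)"] sum.cong)
  also have "\<dots> \<le> (\<Sum>k=2..n+1. f k) + (\<Sum>k=2..n+1. f k)"
    using assms(2) by (intro add_mono le) (auto simp: inj_on_def)
  finally show ?thesis by simp
qed

theorem theorem2p2:
  fixes a b :: complex and n :: nat and s :: real
  assumes "n \<ge> 1" and "s > 0"
  shows "mat_norm_inf (Er n a b) \<le>
    4 * exp (Re b + 2 * cmod a * cosh s) / (exp (s * (2 * real n + 2)) - 1) * (G n s + G n (- s))"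
proof -
  define M where "M = exp (Re b + 2 * cmod a * cosh s) / (exp (s * (2 * real n + 2)) - 1)"
  define S where "S = (\<Sum>k=2..n+1. 2 * cosh (s * real k))"
  have "exp (s * (2 * real n + 2)) > 1" using assms by simp
  then have M: "M \<ge> 0" by (simp add: M_def)
  have S0: "S \<ge> 0" unfolding S_def by (intro sum_nonneg) auto
  have S: "G n s + G n (- s) = S"
    using assms by (simp add: G_conv_sum S_def cosh_def add_divide_distrib sum.distrib)
  have dim: "dim_row (Er n a b) = n" "dim_col (Er n a b) = n"
    by (simp_all add: Er_def Psi_def hankel_def Let_def)
  have row: "(\<Sum>j<n. cmod (Er n a b $$ (i, j))) \<le> 4 * M * S" if i: "i < n" for i
  proof -
    have "(\<Sum>j<n. cmod (Er n a b $$ (i, j)))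
        \<le> (\<Sum>j<n. M * (2 * cosh (s * real (if i + j < n then i + j + 2 else 2 * n - i - j))))"
      using Er_entry_bound[OF assms(2) i] by (intro sum_mono) (auto simp: M_def)
    also have "\<dots> \<le> M * (2 * S)"
      unfolding sum_distrib_left[symmetric] S_def
      using i M by (intro mult_left_mono sum_hankel_index_le) auto
    \<comment> \<open>The count gives the constant 2; nonnegativity of \<open>M * S\<close> allows
      the stated 4.\<close>
    also have "\<dots> \<le> 4 * M * S" using mult_nonneg_nonneg[OF M S0] by simp
    finally show ?thesis .
  qed
  have "mat_norm_inf (Er n a b) \<le> 4 * M * S"
    unfolding mat_norm_inf_def dim using assms(1) row by (subst Max_le_iff) (auto simp: lessThan_empty_iff)
  then show ?thesis by (simp add: S M_def)
qed

end
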